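(* In the adversarial convex body chasing game described in the context, for all $t\in\{1,\dots,T\}$, all $i\in\mathcal V$ and all $j\in\mathcal N_i$, the optimal value functions $V_t(\cdot,j):\mathcal Q_{t-1}^{(i)}\to\mathbb R$ and $U_t(\cdot,i):\mathcal Q_{t-1}^{(i)}\to\mathbb R$ are both continuous.
   Context: Setting. $\mathcal X$ is a compact subset of $\mathbb R^d$ equipped with a norm $\|\cdot\|$; $T\ge 1$ is an integer horizon. A set is solid if it has nonempty interior. A correspondence (set-valued map) $F:A\rightsquigarrow B$ assigns to each point of $A$ a subset of $B$. It is upper semi-continuous at $\mathbf x\in A$ if for every open $O\subseteq B$ with $F(\mathbf x)\subseteq O$ there is a neighborhood $N$ of $\mathbf x$ with $F(\mathbf x')\subseteq O$ for all $\mathbf x'\in N$; lower semi-continuous at $\mathbf x$ if for every open $O\subseteq B$ with $F(\mathbf x)\cap O\ne\emptyset$ there is a neighborhood $N$ of $\mathbf x$ with $F(\mathbf x')\cap O\neq\emptyset$ for all $\mathbf x'\in N$; continuous if it is both at every point. Data. $\mathcal G=(\mathcal V,\mathcal E)$ is a finite directed graph, $\mathcal N_i=\{j\in\mathcal V:(i,j)\in\mathcal E\}$, assumed nonempty for each $i\in\mathcal V$. $\mathcal Q=\{\mathcal Q_t^{(i)}\}_{t=0,\dots,T;\,i\in\mathcal V}$ is a collection of subsets of $\mathcal X$. $\mathcal R:\mathcal X\rightsquigarrow\mathcal X$ is the reachability correspondence, and $c:\mathcal X\times\mathcal X\to\mathbb R$ is a nonnegative cost function. Assumptions. (1) $\mathcal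 R(\mathbf x)$ is solid, compact and convex for all $\mathbf x\in\mathcal X$. (2) Each $\mathcal Q_t^{(i)}$ is solid, compact and convex. (3) For all $t\in\{1,\dots,T\}$, $i\in\mathcal V$, $j\in\mathcal N_i$ and $\mathbf x\in\mathcal Q_{t-1}^{(i)}$: $\mathrm{int}(\mathcal R(\mathbf x)\cap\mathcal Q_t^{(j)})\neq\emptyset$. (4) $c$ is continuous. (5) $\mathcal R$ is continuous. Interiors are taken in $\mathbb R^d$. Write $\Theta_t^{(j)}(\mathbf x)=\mathcal R(\mathbf x)\cap\mathcal Q_t^{(j)}$. Value functions. For $t\in\{1,\dots,T\}$, $V_t(\mathbf x,j)$ is defined for $\mathbf x\in\mathcal Q_{t-1}^{(i)}$ and $j\in\mathcal N_i$ (for some $i\in\mathcal V$), and $U_t(\mathbf x,i)$ for $i\in\mathcal V$, $\mathbf x\in\mathcal Q_{t-1}^{(i)}$, by backward recursion: $$V_T(\mathbf x,j)=\inf_{\mathbf y\in\Theta_T^{(j)}(\mathbf x)}c(\mathbf x,\mathbf y),\qquad V_t(\mathbf x,j)=\inf_{\mathbf y\in\Theta_t^{(j)}(\mathbf x)}\Big\{c(\mathbf x,\mathbf y)+\max_{k\in\mathcal N_j}V_{t+1}(\mathbf y,k)\Big\}\ (1\le t\le T-1),$$ $$U_T(\mathbf x,i)=\max_{j\in\mathcal N_i}\ \inf_{\mathbf y\in\Theta_T^{(j)}(\mathbf x)}c(\mathbf x,\mathbf y),\qquad U_t(\mathbf x,i)=\max_{j\in\mathcal N_i}\ \inf_{\mathbf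 y\in\Theta_t^{(j)}(\mathbf x)}\{c(\mathbf x,\mathbf y)+U_{t+1}(\mathbf y,j)\}\ (1\le t\le T-1).$$ *)

theory Defs
  imports "HOL-Analysis.Analysis" "Graph_Theory.Pair_Digraph"
begin

text \<open>
  The ambient space is \<open>real ^ 'd\<close>. Compactness, interiors and continuity below are purely
  topological, so by the equivalence of norms on a finite-dimensional space they do not depend
  on which norm it is equipped with.
\<close>

definition solid :: "'a::topological_space set \<Rightarrow> bool" where
  "solid S \<longleftrightarrow> interior S \<noteq> {}"

text \<open>
  A correspondence from \<open>A\<close> to \<open>B\<close> is a function \<open>F\<close> with \<open>F x \<subseteq> B\<close> for all \<open>x \<in> A\<close>; its values
  outside \<open>A\<close> are irrelevant. Open sets and neighbourhoods are relative to \<open>B\<close> and \<open>A\<close>.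
\<close>

definition correspondence :: "'a set \<Rightarrow> 'b set \<Rightarrow> ('a \<Rightarrow> 'b set) \<Rightarrow> bool" where
  "correspondence A B F \<longleftrightarrow> (\<forall>x\<in>A. F x \<subseteq> B)"

definition upper_semicontinuous_at ::
  "'a::topological_space set \<Rightarrow> 'b::topological_space set \<Rightarrow> ('a \<Rightarrow> 'b set) \<Rightarrow> 'a \<Rightarrow> bool" where
  "upper_semicontinuous_at A B F x \<longleftrightarrow>
     (\<forall>W. openin (top_of_set B) W \<and> F x \<subseteq> W \<longrightarrow>
        (\<exists>N. openin (top_of_set A) N \<and> x \<in> N \<and> (\<forall>x'\<in>N. F x' \<subseteq> W)))"

definition lower_semicontinuous_at ::
  "'a::topological_space set \<Rightarrow> 'b::topological_space set \<Rightarrow> ('a \<Rightarrow> 'b set) \<Rightarrow> 'a \<Rightarrow> bool" where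
  "lower_semicontinuous_at A B F x \<longleftrightarrow>
     (\<forall>W. openin (top_of_set B) W \<and> F x \<inter> W \<noteq> {} \<longrightarrow>
        (\<exists>N. openin (top_of_set A) N \<and> x \<in> N \<and> (\<forall>x'\<in>N. F x' \<inter> W \<noteq> {})))"

definition continuous_correspondence ::
  "'a::topological_space set \<Rightarrow> 'b::topological_space set \<Rightarrow> ('a \<Rightarrow> 'b set) \<Rightarrow> bool" where
  "continuous_correspondence A B F \<longleftrightarrow>
     (\<forall>x\<in>A. upper_semicontinuous_at A B F x \<and> lower_semicontinuous_at A B F x)"

definition out_nbrs :: "'v pair_pre_digraph \<Rightarrow> 'v \<Rightarrow> 'v set" where
  "out_nbrs G i = {j \<in> pverts G. (i, j) \<in> parcs G}"

definition feasible ::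
  "('a \<Rightarrow> 'a set) \<Rightarrow> (nat \<Rightarrow> 'v \<Rightarrow> 'a set) \<Rightarrow> nat \<Rightarrow> 'v \<Rightarrow> 'a \<Rightarrow> 'a set" where
  "feasible R Q t j x = R x \<inter> Q t j"

text \<open>
  The value functions, by backward recursion from the horizon \<open>T\<close>. They are meant for
  \<open>1 \<le> t \<le> T\<close>; the terminal clause is the case \<open>t = T\<close>, and its values for \<open>t > T\<close> are never used.
\<close>

function V_value ::
  "nat \<Rightarrow> 'v pair_pre_digraph \<Rightarrow> ('a \<Rightarrow> 'a set) \<Rightarrow> (nat \<Rightarrow> 'v \<Rightarrow> 'a set) \<Rightarrow> ('a \<Rightarrow> 'a \<Rightarrow> real) \<Rightarrow>
   nat \<Rightarrow> 'a \<Rightarrow> 'v \<Rightarrow> real" where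
  "V_value T G R Q c t x j =
     (if t < T
      then INF y\<in>feasible R Q t j x.
             c x y + (MAX k\<in>out_nbrs G j. V_value T G R Q c (t + 1) y k)
      else INF y\<in>feasible R Q t j x. c x y)"
  by pat_completeness auto
termination
  by (relation "Wellfounded.measure (\<lambda>(T, G, R, Q, c, t, x, j). T - t)") auto

function U_value ::
  "nat \<Rightarrow> 'v pair_pre_digraph \<Rightarrow> ('a \<Rightarrow> 'a set) \<Rightarrow> (nat \<Rightarrow> 'v \<Rightarrow> 'a set) \<Rightarrow> ('a \<Rightarrow> 'a \<Rightarrow> real) \<Rightarrow>
   nat \<Rightarrow> 'a \<Rightarrow> 'v \<Rightarrow> real" where
  "U_value T G R Q c t x i =
     (if t < T
      then MAX j\<in>out_nbrs G i. INF y\<in>feasible R Q t j x. c x y + U_value T G R Q c (t + 1) y j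
      else MAX j\<in>out_nbrs G i. INF y\<in>feasible R Q t j x. c x y)"
  by pat_completeness auto
termination
  by (relation "Wellfounded.measure (\<lambda>(T, G, R, Q, c, t, x, i). T - t)") auto

declare V_value.simps [simp del] U_value.simps [simp del]

lemma V_value_terminal: "V_value T G R Q c T x j = (INF y\<in>feasible R Q T j x. c x y)"
  by (simp add: V_value.simps)

lemma V_value_step:
  "t < T \<Longrightarrow> V_value T G R Q c t x j =
     (INF y\<in>feasible R Q t j x. c x y + (MAX k\<in>out_nbrs G j. V_value T G R Q c (t + 1) y k))"
  by (subst V_value.simps) simp

lemma U_value_terminal:
  "U_value T G R Q c T x i = (MAX j\<in>out_nbrs G i. INF y\<in>feasible R Q T j x. c x y)"
  by (simp add: U_value.simps)

lemma U_value_step: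
  "t < T \<Longrightarrow> U_value T G R Q c t x i =
     (MAX j\<in>out_nbrs G i. INF y\<in>feasible R Q t j x. c x y + U_value T G R Q c (t + 1) y j)"
  by (subst U_value.simps) simp

end

theory Submission
  imports Defs
begin

text \<open>
  By backward induction on \<open>t\<close> and Berge's minimum theorem, everything reduces to the continuity of
  \<open>\<Theta>(x) = R(x) \<inter> Q\<close>. Upper semicontinuity only needs \<open>Q\<close> closed. For lower semicontinuity, a point
  of \<open>\<Theta>(x)\<close> in an open set \<open>W\<close> can be moved into the interior of the convex body \<open>\<Theta>(x)\<close> without
  leaving \<open>W\<close>; it then lies in the open set \<open>W \<inter> int Q\<close>, which \<open>R(x')\<close> still meets for \<open>x'\<close> close
  to \<open>x\<close>.
\<close>

lemma upper_semicontinuous_at_Int_closed: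
  assumes "upper_semicontinuous_at X Y R x" "closed Q" "Q \<subseteq> Y" "A \<subseteq> X" "x \<in> A"
    and "\<And>x. x \<in> X \<Longrightarrow> R x \<subseteq> Y"
  shows "upper_semicontinuous_at A Q (\<lambda>x. R x \<inter> Q) x"
  unfolding upper_semicontinuous_at_def
proof (intro allI impI)
  fix W assume W: "openin (top_of_set Q) W \<and> R x \<inter> Q \<subseteq> W"
  then obtain W0 where W0: "open W0" "W = Q \<inter> W0" by (auto simp: openin_open)
  \<comment> \<open>\<open>R x' \<inter> Q \<subseteq> W0\<close> says the same as
    \<open>R x' \<subseteq> W0 \<union> - Q\<close>, so the constraint \<open>Q\<close> is absorbed
    into the open target and upper semicontinuity of \<open>R\<close> itself applies.\<close>
  have "open (W0 \<union> - Q)" using W0 assms(2) by auto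
  then have "openin (top_of_set Y) (Y \<inter> (W0 \<union> - Q))" by blast
  moreover have "R x \<subseteq> Y \<inter> (W0 \<union> - Q)" using W W0 assms(4-6) by blast
  ultimately obtain N where N: "openin (top_of_set X) N" "x \<in> N"
    "\<forall>x'\<in>N. R x' \<subseteq> Y \<inter> (W0 \<union> - Q)"
    using assms(1) unfolding upper_semicontinuous_at_def by meson
  have "openin (top_of_set A) (A \<inter> N)"
    using N(1) assms(4) by (auto simp: openin_open)
  moreover have "\<forall>x'\<in>A \<inter> N. R x' \<inter> Q \<subseteq> W" using N(3) W0(2) by blast
  ultimately show "\<exists>N. openin (top_of_set A) N \<and> x \<in> N \<and> (\<forall>x'\<in>N. R x' \<inter> Q \<subseteq> W)"
    using N(2) assms(5) by blast
qed

text \<open>The nonempty interior acts as a constraint qualification. If \<open>R x\<close> and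
  \<open>Q\<close> merely touched, a small change of \<open>x\<close> could pull them apart and make
  the intersection empty.\<close>

lemma lower_semicontinuous_at_Int_convex:
  fixes R :: "'a::topological_space \<Rightarrow> 'b::euclidean_space set"
  assumes "lower_semicontinuous_at X Y R x" "Q \<subseteq> Y" "A \<subseteq> X" "x \<in> A"
    and "convex (R x \<inter> Q)" "interior (R x \<inter> Q) \<noteq> {}"
  shows "lower_semicontinuous_at A Q (\<lambda>x. R x \<inter> Q) x"
  unfolding lower_semicontinuous_at_def
proof (intro allI impI)
  fix W assume W: "openin (top_of_set Q) W \<and> R x \<inter> Q \<inter> W \<noteq> {}"
  then obtain W0 where W0: "open W0" "W = Q \<inter> W0" by (auto simp: openin_open)
  have "R x \<inter> Q \<subseteq> closure (interior (R x \<inter> Q))"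
    using convex_closure_interior[OF assms(5,6)] closure_subset by metis
  then have "W0 \<inter> interior (R x \<inter> Q) \<noteq> {}"
    using W W0 open_Int_closure_eq_empty[OF W0(1), of "interior (R x \<inter> Q)"] by blast
  \<comment> \<open>\<open>W\<close> is open only relative to \<open>Q\<close>. Replacing
    \<open>Q\<close> by \<open>interior Q\<close> gives a test set that is open relative to
    \<open>Y\<close>, as lower semicontinuity of \<open>R\<close> requires, and that still lies in
    \<open>W\<close>.\<close>
  then have "R x \<inter> (Y \<inter> (W0 \<inter> interior Q)) \<noteq> {}"
    using assms(2) interior_subset[of "R x \<inter> Q"] interior_mono[of "R x \<inter> Q" Q] by blast
  moreover have "openin (top_of_set Y) (Y \<inter> (W0 \<inter> interior Q))"
    using W0(1) by (intro openin_open_Int open_Int) auto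
  ultimately obtain N where N: "openin (top_of_set X) N" "x \<in> N"
    "\<forall>x'\<in>N. R x' \<inter> (Y \<inter> (W0 \<inter> interior Q)) \<noteq> {}"
    using assms(1) unfolding lower_semicontinuous_at_def by meson
  have "openin (top_of_set A) (A \<inter> N)"
    using N(1) assms(3) by (auto simp: openin_open)
  moreover have "\<forall>x'\<in>A \<inter> N. R x' \<inter> Q \<inter> W \<noteq> {}"
    using N(3) W0(2) interior_subset[of Q] by blast
  ultimately show "\<exists>N. openin (top_of_set A) N \<and> x \<in> N \<and> (\<forall>x'\<in>N. R x' \<inter> Q \<inter> W \<noteq> {})"
    using N(2) assms(4) by blast
qed

text \<open>Strict superlevel sets of the minimum are open by upper semicontinuity and the tube
  lemma; strict sublevel sets are open by lower semicontinuity, which lets one good choice of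
  \<open>y\<close> persist.\<close>

theorem Berge_minimum:
  fixes f :: "'a::topological_space \<Rightarrow> 'b::topological_space \<Rightarrow> real"
  assumes cont: "continuous_on (A \<times> B) (\<lambda>(x, y). f x y)"
    and corr: "correspondence A B F" "continuous_correspondence A B F"
    and F: "\<And>x. x \<in> A \<Longrightarrow> compact (F x)" "\<And>x. x \<in> A \<Longrightarrow> F x \<noteq> {}"
  shows "continuous_on A (\<lambda>x. INF y\<in>F x. f x y)"
proof -
  let ?g = "\<lambda>x. INF y\<in>F x. f x y"
  have FB: "F x \<subseteq> B" if "x \<in> A" for x
    using corr(1) that by (auto simp: correspondence_def)
  have usc: "upper_semicontinuous_at A B F x" and lsc: "lower_semicontinuous_at A B F x"
    if "x \<in> A" for x
    using corr(2) that by (auto simp: continuous_correspondence_def)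
  have min: "\<exists>y\<in>F x. ?g x = f x y \<and> (\<forall>z\<in>F x. f x y \<le> f x z)" if x: "x \<in> A" for x
  proof -
    have "continuous_on (F x) (\<lambda>y. (\<lambda>(x, y). f x y) (x, y))"
      using x FB[OF x] by (intro continuous_on_compose2[OF cont] continuous_intros) auto
    then have "continuous_on (F x) (f x)" by simp
    then obtain y where y: "y \<in> F x" "\<forall>z\<in>F x. f x y \<le> f x z"
      using continuous_attains_inf[OF F(1)[OF x] F(2)[OF x]] by blast
    then have "?g x = f x y" by (intro cInf_eq_minimum) auto
    with y show ?thesis by blast
  qed
  \<comment> \<open>Attainment of the infimum is what makes the second equivalence strict: values
    above \<open>a\<close> alone would only give an infimum of at least \<open>a\<close>.\<close>
  have less: "?g x < a \<longleftrightarrow> (\<exists>y\<in>F x. f x y < a)" and greater: "?g x > a \<longleftrightarrow> (\<forall>y\<in>F x. f x y > a)"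
    if "x \<in> A" for x a
    using min[OF that] by force+
  have f_open: "openin (prod_topology (top_of_set A) (top_of_set B)) {p \<in> A \<times> B. (\<lambda>(x, y). f x y) p > a}"
    "openin (prod_topology (top_of_set A) (top_of_set B)) {p \<in> A \<times> B. (\<lambda>(x, y). f x y) p < a}" for a
    using cont continuous_map_upper_lower_semicontinuous_lt[of "top_of_set (A \<times> B)" "\<lambda>(x, y). f x y"]
    by (simp_all add: del: openin_subtopology)
  have "openin (top_of_set A) {x \<in> A. ?g x > a}" for a
  proof (subst openin_subopen, intro ballI)
    fix x assume "x \<in> {x \<in> A. ?g x > a}"
    then have x: "x \<in> A" "\<forall>y\<in>F x. f x y > a" using greater by auto
    have comp: "compactin (top_of_set B) (F x)" using F(1)[OF x(1)] FB[OF x(1)] by (simp add: compactin_subtopology)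
    have sub: "{x} \<times> F x \<subseteq> {p \<in> A \<times> B. (\<lambda>(x, y). f x y) p > a}" using x FB[OF x(1)] by auto
    \<comment> \<open>Compactness of \<open>F x\<close> yields a single \<open>U\<close> that works
      for all \<open>y\<close> in a neighbourhood \<open>V\<close> of \<open>F x\<close>; upper
      semicontinuity then keeps \<open>F x'\<close> inside \<open>V\<close>.\<close>
    obtain U V where UV: "openin (top_of_set A) U" "openin (top_of_set B) V" "x \<in> U"
      "F x \<subseteq> V" "U \<times> V \<subseteq> {p \<in> A \<times> B. (\<lambda>(x, y). f x y) p > a}"
      using tube_lemma_right[OF f_open(1)[of a] comp _ sub] x(1) by auto
    obtain N where N: "openin (top_of_set A) N" "x \<in> N" "\<forall>x'\<in>N. F x' \<subseteq> V"
      using usc[OF x(1)] UV(2,4) unfolding upper_semicontinuous_at_def by meson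
    have "U \<inter> N \<subseteq> {x \<in> A. ?g x > a}"
    proof
      fix x' assume x': "x' \<in> U \<inter> N"
      then have "x' \<in> A" using UV(1) openin_imp_subset by blast
      moreover have "\<forall>y\<in>F x'. f x' y > a" using x' N(3) UV(5) by fastforce
      ultimately show "x' \<in> {x \<in> A. ?g x > a}" using greater by simp
    qed
    then show "\<exists>M. openin (top_of_set A) M \<and> x \<in> M \<and> M \<subseteq> {x \<in> A. ?g x > a}"
      using UV(1,3) N(1,2) by (intro exI[of _ "U \<inter> N"]) auto
  qed
  moreover have "openin (top_of_set A) {x \<in> A. ?g x < a}" for a
  proof (subst openin_subopen, intro ballI)
    fix x assume "x \<in> {x \<in> A. ?g x < a}"
    then obtain y where x: "x \<in> A" and y: "y \<in> F x" "f x y < a" using less by auto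
    \<comment> \<open>A box around this one pair suffices here, since lower semicontinuity supplies
      a point of \<open>F x'\<close> in \<open>V\<close> for \<open>x'\<close> near
      \<open>x\<close>.\<close>
    have "(x, y) \<in> {p \<in> A \<times> B. (\<lambda>(x, y). f x y) p < a}" using x y FB[OF x] by auto
    then obtain U V where UV: "openin (top_of_set A) U" "openin (top_of_set B) V" "x \<in> U"
      "y \<in> V" "U \<times> V \<subseteq> {p \<in> A \<times> B. (\<lambda>(x, y). f x y) p < a}"
      using f_open(2)[of a] unfolding openin_prod_topology_alt by meson
    obtain N where N: "openin (top_of_set A) N" "x \<in> N" "\<forall>x'\<in>N. F x' \<inter> V \<noteq> {}"
      using lsc[OF x, unfolded lower_semicontinuous_at_def, rule_format, of V] UV(2,4) y(1) by blast
    have "U \<inter> N \<subseteq> {x \<in> A. ?g x < a}"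
    proof
      fix x' assume x': "x' \<in> U \<inter> N"
      then have "x' \<in> A" using UV(1) openin_imp_subset by blast
      moreover have "\<exists>y\<in>F x'. f x' y < a" using x' N(3) UV(5) by fastforce
      ultimately show "x' \<in> {x \<in> A. ?g x < a}" using less by simp
    qed
    then show "\<exists>M. openin (top_of_set A) M \<and> x \<in> M \<and> M \<subseteq> {x \<in> A. ?g x < a}"
      using UV(1,3) N(1,2) by (intro exI[of _ "U \<inter> N"]) auto
  qed
  ultimately show ?thesis
    using continuous_map_upper_lower_semicontinuous_lt[of "top_of_set A" ?g] by simp
qed

lemma continuous_on_Max_image:
  fixes f :: "'k \<Rightarrow> 'a::topological_space \<Rightarrow> 'b::linorder_topology"
  assumes "finite K" "K \<noteq> {}" "\<And>k. k \<in> K \<Longrightarrow> continuous_on S (f k)"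
  shows "continuous_on S (\<lambda>x. MAX k\<in>K. f k x)"
  using assms
proof (induction K rule: finite_ne_induct)
  case (insert k K)
  have "(MAX k\<in>insert k K. f k x) = max (f k x) (MAX k\<in>K. f k x)" for x
    using insert.hyps by (simp add: Max_insert)
  then show ?case using insert by (simp add: continuous_on_max)
qed simp

theorem theorem1:
  fixes X :: "(real ^ 'd) set"
    and T :: nat
    and G :: "'v pair_pre_digraph"
    and Q :: "nat \<Rightarrow> 'v \<Rightarrow> (real ^ 'd) set"
    and R :: "real ^ 'd \<Rightarrow> (real ^ 'd) set"
    and c :: "real ^ 'd \<Rightarrow> real ^ 'd \<Rightarrow> real"
  assumes X_compact: "compact X"
    and horizon: "1 \<le> T"
    and graph: "pair_fin_digraph G"
    and nbrs_nonempty: "\<forall>i\<in>pverts G. out_nbrs G i \<noteq> {}"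
    and Q_subset: "\<forall>t\<in>{0..T}. \<forall>i\<in>pverts G. Q t i \<subseteq> X"
    and R_corr: "correspondence X X R"
    and c_nonneg: "\<forall>x\<in>X. \<forall>y\<in>X. 0 \<le> c x y"
    and R_bodies: "\<forall>x\<in>X. solid (R x) \<and> compact (R x) \<and> convex (R x)"
    and Q_bodies: "\<forall>t\<in>{0..T}. \<forall>i\<in>pverts G. solid (Q t i) \<and> compact (Q t i) \<and> convex (Q t i)"
    and feasibility: "\<forall>t\<in>{1..T}. \<forall>i\<in>pverts G. \<forall>j\<in>out_nbrs G i. \<forall>x\<in>Q (t - 1) i.
                        interior (R x \<inter> Q t j) \<noteq> {}"
    and c_cont: "continuous_on (X \<times> X) (\<lambda>(x, y). c x y)"
    and R_cont: "continuous_correspondence X X R"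
  shows "\<forall>t\<in>{1..T}. \<forall>i\<in>pverts G. \<forall>j\<in>out_nbrs G i.
           continuous_on (Q (t - 1) i) (\<lambda>x. V_value T G R Q c t x j) \<and>
           continuous_on (Q (t - 1) i) (\<lambda>x. U_value T G R Q c t x i)"
proof -
  have fin: "finite (out_nbrs G i)" for i
    using pair_fin_digraph.pair_finite_verts[OF graph] by (simp add: out_nbrs_def)
  have vert: "j \<in> pverts G" if "j \<in> out_nbrs G i" for i j
    using that by (simp add: out_nbrs_def)
  \<comment> \<open>The arbitrary continuation cost \<open>h\<close> covers both recursions at once.
    It is known to be continuous only on \<open>Q t j\<close>, so Berge's theorem is applied with
    codomain \<open>Q t j\<close> instead of \<open>X\<close>.\<close>
  have inf_cont: "continuous_on (Q (t - 1) i) (\<lambda>x. INF y\<in>feasible R Q t j x. c x y + h y)"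
    if t: "t \<in> {1..T}" and i: "i \<in> pverts G" and j: "j \<in> out_nbrs G i"
      and h: "continuous_on (Q t j) h" for t i j h
  proof (rule Berge_minimum)
    note jv = vert[OF j]
    have "t - 1 \<in> {0..T}" "t \<in> {0..T}" using t by auto
    then have A: "Q (t - 1) i \<subseteq> X" and B: "Q t j \<subseteq> X" using Q_subset i jv by blast+
    have Qj: "compact (Q t j)" "convex (Q t j)" using Q_bodies t jv by auto
    have RX: "R x \<subseteq> X" if "x \<in> X" for x using R_corr that by (auto simp: correspondence_def)
    \<comment> \<open>This serves twice: for lower semicontinuity of the feasible correspondence and
      for nonemptiness of its values.\<close>
    have int: "interior (R x \<inter> Q t j) \<noteq> {}" if "x \<in> Q (t - 1) i" for x
      using feasibility t i j that by blast
    have "continuous_on (Q (t - 1) i \<times> Q t j) (\<lambda>(x, y). c x y)"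
      using A B by (intro continuous_on_subset[OF c_cont]) auto
    moreover have "continuous_on (Q (t - 1) i \<times> Q t j) (\<lambda>p. h (snd p))"
      by (intro continuous_on_compose2[OF h] continuous_intros) auto
    ultimately show "continuous_on (Q (t - 1) i \<times> Q t j) (\<lambda>(x, y). c x y + h y)"
      by (simp add: case_prod_unfold continuous_on_add)
    show "correspondence (Q (t - 1) i) (Q t j) (feasible R Q t j)"
      by (auto simp: correspondence_def feasible_def)
    have "upper_semicontinuous_at (Q (t - 1) i) (Q t j) (\<lambda>x. R x \<inter> Q t j) x \<and>
        lower_semicontinuous_at (Q (t - 1) i) (Q t j) (\<lambda>x. R x \<inter> Q t j) x"
      if x: "x \<in> Q (t - 1) i" for x
    proof
      have xX: "x \<in> X" using x A by auto
      show "upper_semicontinuous_at (Q (t - 1) i) (Q t j) (\<lambda>x. R x \<inter> Q t j) x"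
        using R_cont xX upper_semicontinuous_at_Int_closed[OF _ compact_imp_closed[OF Qj(1)] B A x RX]
        by (auto simp: continuous_correspondence_def)
      show "lower_semicontinuous_at (Q (t - 1) i) (Q t j) (\<lambda>x. R x \<inter> Q t j) x"
        using R_cont R_bodies xX Qj(2)
        by (intro lower_semicontinuous_at_Int_convex[where R = R, OF _ B A x _ int[OF x]] convex_Int)
          (auto simp: continuous_correspondence_def)
    qed
    then show "continuous_correspondence (Q (t - 1) i) (Q t j) (feasible R Q t j)"
      by (simp add: continuous_correspondence_def feasible_def[abs_def])
    show "compact (feasible R Q t j x)" if "x \<in> Q (t - 1) i" for x
      using R_bodies Qj(1) A that by (auto simp: feasible_def intro!: compact_Int)
    show "feasible R Q t j x \<noteq> {}" if "x \<in> Q (t - 1) i" for x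
      using int[OF that] interior_subset by (fastforce simp: feasible_def)
  qed
  have value_cont: "\<forall>i\<in>pverts G. (\<forall>j\<in>out_nbrs G i.
            continuous_on (Q (t - 1) i) (\<lambda>x. V_value T G R Q c t x j)) \<and>
          continuous_on (Q (t - 1) i) (\<lambda>x. U_value T G R Q c t x i)"
    if "t \<le> T" "1 \<le> t" for t
    using that
  proof (induction t rule: inc_induct)
    case base
    have "continuous_on (Q (T - 1) i) (\<lambda>x. INF y\<in>feasible R Q T j x. c x y)"
      if "i \<in> pverts G" "j \<in> out_nbrs G i" for i j
      \<comment> \<open>The terminal stage is the case of zero continuation cost.\<close>
      using inf_cont[of T i j "\<lambda>_. 0"] that horizon by auto
    then show ?case
      using nbrs_nonempty fin
      by (auto simp: V_value_terminal U_value_terminal intro!: continuous_on_Max_image)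
  next
    case (step t)
    \<comment> \<open>The value functions of stage \<open>Suc t\<close> at vertex \<open>j\<close>
      live on \<open>Q (Suc t - 1) j = Q t j\<close>, exactly the domain on which
      \<open>inf_cont\<close> wants \<open>h\<close> to be continuous. For \<open>V_value\<close>
      the continuation is first maximised over the finitely many successors \<open>k\<close>; for
      \<open>U_value\<close> the maximum over \<open>j\<close> is taken after the infimum.\<close>
    have IH: "continuous_on (Q t j) (\<lambda>y. MAX k\<in>out_nbrs G j. V_value T G R Q c (Suc t) y k)"
      "continuous_on (Q t j) (\<lambda>y. U_value T G R Q c (Suc t) y j)" if "j \<in> pverts G" for j
      using step.IH that nbrs_nonempty fin by (auto intro!: continuous_on_Max_image)
    have t: "t \<in> {1..T}" using step by auto
    show ?case
      using nbrs_nonempty fin \<open>t < T\<close>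
      by (auto simp: V_value_step U_value_step intro!: continuous_on_Max_image
          inf_cont[unfolded One_nat_def, OF t[unfolded One_nat_def]] IH vert)
  qed
  then show ?thesis by auto
qed

end
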